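(* Let $R=\mathbb F_{q_1}\times\cdots\times\mathbb F_{q_t}$ be a product of $t\ge 3$ finite fields of orders $q_1,\dots,q_t$. For nonempty proper $A\subsetneq[t]$, write $\mathrm{val}(A)=\prod_{i\in A}(q_i-1)$ if $|A|\le t-2$ and $\mathrm{val}(A)=1$ if $|A|=t-1$. Pair the $2^t-2$ nonempty proper subsets of $[t]$ into $2^{t-1}-1$ complementary pairs $\{A,[t]\setminus A\}$. Then $$\omega(\mathcal D(R))\ \le\ \sum_{\{A,[t]\setminus A\}}\max\bigl(\mathrm{val}(A),\ \mathrm{val}([t]\setminus A)\bigr),$$ the sum being over all these complementary pairs.
   Context: $[t]=\{1,\dots,t\}$. $Z(R)$ is the set of zero-divisors of $R$ and $Z(R)^*=Z(R)\setminus\{0\}$. $\Gamma(R)$ is the simple graph with vertex set $Z(R)^*$, with distinct $x,y$ adjacent iff $xy=0$. $W\Gamma(R)$ is the simple graph with vertex set $Z(R)^*$, with distinct $x,y$ adjacent iff there exist nonzero $r\in\operatorname{Ann}(x)$ and nonzero $s\in\operatorname{Ann}(y)$ with $rs=0$. The weak zero-divisor difference graph $\mathcal D(R)$ is the graph on $Z(R)^*$ with edge set $E(W\Gamma(R))\setminus E(\Gamma(R))$, with resulting isolated vertices deleted. $\omega(G)$ is the clique number of $G$. *)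

theory Defs
  imports "HOL-Algebra.Algebra" "HOL-Library.Ramsey"
begin

text \<open>A simple graph is a pair (vertex set, set of two-element edges).\<close>

type_synonym 'v sgraph = "'v set \<times> 'v set set"

text \<open>\<open>Max\<close> is meaningful here for finite graphs; \<open>clique\<close> is the predicate from
  \<^theory>\<open>HOL-Library.Ramsey\<close>.\<close>

definition clique_number :: "'v sgraph \<Rightarrow> nat" where
  "clique_number G = Max {card K | K. K \<subseteq> fst G \<and> clique K (snd G)}"

definition delete_isolated :: "'v sgraph \<Rightarrow> 'v sgraph" where
  "delete_isolated G = ({x \<in> fst G. \<exists>e \<in> snd G. x \<in> e}, snd G)"

text \<open>The rings below are meant to be commutative, so no sides are distinguished.\<close>

definition zero_divisors :: "('a, 'b) ring_scheme \<Rightarrow> 'a set" where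
  "zero_divisors R = {x \<in> carrier R. \<exists>y \<in> carrier R - {\<zero>\<^bsub>R\<^esub>}. x \<otimes>\<^bsub>R\<^esub> y = \<zero>\<^bsub>R\<^esub>}"

definition nonzero_zero_divisors :: "('a, 'b) ring_scheme \<Rightarrow> 'a set" where
  "nonzero_zero_divisors R = zero_divisors R - {\<zero>\<^bsub>R\<^esub>}"

definition annihilator :: "('a, 'b) ring_scheme \<Rightarrow> 'a \<Rightarrow> 'a set" where
  "annihilator R x = {r \<in> carrier R. r \<otimes>\<^bsub>R\<^esub> x = \<zero>\<^bsub>R\<^esub>}"

definition zero_divisor_graph :: "('a, 'b) ring_scheme \<Rightarrow> 'a sgraph" where
  "zero_divisor_graph R =
    (nonzero_zero_divisors R,
     {{x, y} | x y. x \<in> nonzero_zero_divisors R \<and> y \<in> nonzero_zero_divisors R \<and> x \<noteq> y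
        \<and> x \<otimes>\<^bsub>R\<^esub> y = \<zero>\<^bsub>R\<^esub>})"

definition weak_zero_divisor_graph :: "('a, 'b) ring_scheme \<Rightarrow> 'a sgraph" where
  "weak_zero_divisor_graph R =
    (nonzero_zero_divisors R,
     {{x, y} | x y. x \<in> nonzero_zero_divisors R \<and> y \<in> nonzero_zero_divisors R \<and> x \<noteq> y
        \<and> (\<exists>r \<in> annihilator R x - {\<zero>\<^bsub>R\<^esub>}. \<exists>s \<in> annihilator R y - {\<zero>\<^bsub>R\<^esub>}.
              r \<otimes>\<^bsub>R\<^esub> s = \<zero>\<^bsub>R\<^esub>)})"

definition weak_zero_divisor_difference_graph :: "('a, 'b) ring_scheme \<Rightarrow> 'a sgraph" where
  "weak_zero_divisor_difference_graph R =
    delete_isolated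
      (nonzero_zero_divisors R,
       snd (weak_zero_divisor_graph R) - snd (zero_divisor_graph R))"

text \<open>Only used for nonempty proper subsets \<open>A\<close> of \<open>{1..t}\<close> with \<open>t \<ge> 3\<close>, so the second branch
  is exactly the case \<open>card A = t - 1\<close>.\<close>

definition val :: "nat \<Rightarrow> (nat \<Rightarrow> nat) \<Rightarrow> nat set \<Rightarrow> nat" where
  "val t q A = (if card A \<le> t - 2 then \<Prod>i\<in>A. (q i - 1) else 1)"

definition complementary_pairs :: "nat \<Rightarrow> nat set set set" where
  "complementary_pairs t = {{A, {1..t} - A} | A. A \<noteq> {} \<and> A \<subset> {1..t}}"

end

theory Submission
  imports Defs
begin

text \<open>
  Up to units, an element of a product of fields is its support. Distinct nonzero zero divisors are
  adjacent in the difference graph exactly if their supports meet and are not the same set of size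
  \<open>t - 1\<close>. Hence the supports occurring in a clique never form a complementary pair, and the
  elements of the clique with support \<open>A\<close> number at most \<open>val A\<close>: there are only
  \<open>\<Prod>i\<in>A. (q i - 1)\<close> elements with support \<open>A\<close>, and at most one of them is in the clique
  if \<open>card A = t - 1\<close>.
\<close>

section \<open>Componentwise arithmetic in \<open>RDirProd_list\<close>\<close>

lemma RDirProd_list_zero_nth:
  "i < length Rs \<Longrightarrow> \<zero>\<^bsub>RDirProd_list Rs\<^esub> ! i = \<zero>\<^bsub>Rs ! i\<^esub>"
proof (induction Rs arbitrary: i)
  case (Cons R Rs)
  then show ?case by (cases i) (simp_all add: RDirProd_list_zero')
qed simp

lemma length_RDirProd_list_zero: "length \<zero>\<^bsub>RDirProd_list Rs\<^esub> = length Rs"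
  by (induction Rs) (simp_all add: RDirProd_list_zero del: RDirProd_list_nil)

text \<open>Consing is a homomorphism from the binary product of \<open>R\<close> with
  \<open>RDirProd_list Rs\<close>, where multiplication is componentwise. This is the inductive step
  for \<open>RDirProd_list_mult\<close>.\<close>

lemma RDirProd_list_mult_Cons:
  assumes "x \<in> carrier R" "y \<in> carrier R"
    and "xs \<in> carrier (RDirProd_list Rs)" "ys \<in> carrier (RDirProd_list Rs)"
  shows "(x # xs) \<otimes>\<^bsub>RDirProd_list (R # Rs)\<^esub> (y # ys)
    = (x \<otimes>\<^bsub>R\<^esub> y) # (xs \<otimes>\<^bsub>RDirProd_list Rs\<^esub> ys)"
  using ring_hom_mult[OF RDirProd_list_hom1, of "(x, xs)" R Rs "(y, ys)"] assms
  by (simp add: RDirProd_carrier) (simp add: RDirProd_def DirProd_def monoid.defs)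

lemma RDirProd_list_mult:
  assumes "x \<in> carrier (RDirProd_list Rs)" "y \<in> carrier (RDirProd_list Rs)"
  shows "length (x \<otimes>\<^bsub>RDirProd_list Rs\<^esub> y) = length Rs"
    and "i < length Rs \<Longrightarrow> (x \<otimes>\<^bsub>RDirProd_list Rs\<^esub> y) ! i = (x ! i) \<otimes>\<^bsub>Rs ! i\<^esub> (y ! i)"
proof -
  have "length (x \<otimes>\<^bsub>RDirProd_list Rs\<^esub> y) = length Rs
    \<and> (\<forall>i < length Rs. (x \<otimes>\<^bsub>RDirProd_list Rs\<^esub> y) ! i = (x ! i) \<otimes>\<^bsub>Rs ! i\<^esub> (y ! i))"
    using assms
  proof (induction Rs arbitrary: x y)
    case Nil
    then show ?case by (simp add: monoid.defs)
  next
    case (Cons R Rs)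
    from Cons.prems obtain a as b bs where
      xy: "x = a # as" "y = b # bs"
      and "a \<in> carrier R" "b \<in> carrier R"
      and as: "as \<in> carrier (RDirProd_list Rs)" "bs \<in> carrier (RDirProd_list Rs)"
      by (auto simp: RDirProd_list_carrier)
    then have "x \<otimes>\<^bsub>RDirProd_list (R # Rs)\<^esub> y
        = (a \<otimes>\<^bsub>R\<^esub> b) # (as \<otimes>\<^bsub>RDirProd_list Rs\<^esub> bs)"
      by (simp add: RDirProd_list_mult_Cons)
    with Cons.IH[OF as] show ?case
      by (auto simp: xy nth_Cons split: nat.split)
  qed
  then show "length (x \<otimes>\<^bsub>RDirProd_list Rs\<^esub> y) = length Rs"
    and "i < length Rs \<Longrightarrow> (x \<otimes>\<^bsub>RDirProd_list Rs\<^esub> y) ! i = (x ! i) \<otimes>\<^bsub>Rs ! i\<^esub> (y ! i)"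
    by blast+
qed

section \<open>Coordinates and supports in a finite product of finite fields\<close>

locale product_of_fields =
  fixes F :: "nat \<Rightarrow> ('a, 'b) ring_scheme" and t :: nat
  assumes is_field: "i \<in> {1..t} \<Longrightarrow> field (F i)"
    and finite_factor: "i \<in> {1..t} \<Longrightarrow> finite (carrier (F i))"
begin

definition R :: "'a list ring" where
  "R = RDirProd_list (map F [1..<t + 1])"

text \<open>The factors are numbered from 1, list positions from 0.\<close>

definition coord :: "'a list \<Rightarrow> nat \<Rightarrow> 'a" where
  "coord x i = x ! (i - 1)"

definition support :: "'a list \<Rightarrow> nat set" where
  "support x = {i \<in> {1..t}. coord x i \<noteq> \<zero>\<^bsub>F i\<^esub>}"

lemma factor_nth:
  assumes "i \<in> {1..t}"
  shows "i - 1 < length (map F [1..<t + 1])" and "map F [1..<t + 1] ! (i - 1) = F i"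
  using assms nth_map_upt[of "i - 1" "t + 1" 1 F] by (auto simp del: upt_Suc)

lemma coord_closed:
  assumes "x \<in> carrier R" "i \<in> {1..t}"
  shows "coord x i \<in> carrier (F i)"
  using RDirProd_list_carrier_mem(2)[of x "map F [1..<t + 1]" "i - 1"] factor_nth[OF assms(2)] assms
  by (simp add: R_def coord_def del: upt_Suc One_nat_def)

lemma coord_zero: "i \<in> {1..t} \<Longrightarrow> coord \<zero>\<^bsub>R\<^esub> i = \<zero>\<^bsub>F i\<^esub>"
  using RDirProd_list_zero_nth[of "i - 1" "map F [1..<t + 1]"] factor_nth[of i]
  by (simp add: R_def coord_def del: upt_Suc One_nat_def)

lemma coord_mult:
  assumes "x \<in> carrier R" "y \<in> carrier R" "i \<in> {1..t}"
  shows "coord (x \<otimes>\<^bsub>R\<^esub> y) i = coord x i \<otimes>\<^bsub>F i\<^esub> coord y i"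
  using RDirProd_list_mult(2)[of x "map F [1..<t + 1]" y "i - 1"] factor_nth[OF assms(3)] assms
  by (simp add: R_def coord_def del: upt_Suc One_nat_def)

text \<open>Asking for the length instead of membership in the carrier makes this applicable to zero
  and, through \<open>support_eq_empty_iff\<close>, to products, without first proving closure
  properties of \<open>R\<close>.\<close>

lemma coord_eqI:
  assumes "length x = t" "length y = t" "\<And>i. i \<in> {1..t} \<Longrightarrow> coord x i = coord y i"
  shows "x = y"
proof (rule nth_equalityI)
  fix k assume "k < length x"
  with assms(1) assms(3)[of "Suc k"] show "x ! k = y ! k" by (simp add: coord_def)
qed (simp add: assms)

lemma length_carrier: "x \<in> carrier R \<Longrightarrow> length x = t"
  using RDirProd_list_carrier_mem(1)[of x "map F [1..<t + 1]"] by (simp add: R_def)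

lemma length_zero: "length \<zero>\<^bsub>R\<^esub> = t"
  by (simp add: R_def length_RDirProd_list_zero)

lemma length_mult: "x \<in> carrier R \<Longrightarrow> y \<in> carrier R \<Longrightarrow> length (x \<otimes>\<^bsub>R\<^esub> y) = t"
  using RDirProd_list_mult(1)[of x "map F [1..<t + 1]" y] by (simp add: R_def)

lemma support_subset: "support x \<subseteq> {1..t}"
  by (auto simp: support_def)

lemma support_eq_empty_iff:
  assumes "length x = t"
  shows "support x = {} \<longleftrightarrow> x = \<zero>\<^bsub>R\<^esub>"
proof
  assume "support x = {}"
  then show "x = \<zero>\<^bsub>R\<^esub>"
    by (intro coord_eqI) (auto simp: assms length_zero coord_zero support_def)
qed (auto simp: support_def coord_zero)

text \<open>Each factor is an integral domain, so a coordinate of the product vanishes exactly if it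
  vanishes in \<open>x\<close> or in \<open>y\<close>. This turns every question about annihilation
  into one about disjoint sets.\<close>

lemma support_mult:
  assumes "x \<in> carrier R" "y \<in> carrier R"
  shows "support (x \<otimes>\<^bsub>R\<^esub> y) = support x \<inter> support y"
proof -
  have "coord (x \<otimes>\<^bsub>R\<^esub> y) i = \<zero>\<^bsub>F i\<^esub> \<longleftrightarrow> coord x i = \<zero>\<^bsub>F i\<^esub> \<or> coord y i = \<zero>\<^bsub>F i\<^esub>"
    if "i \<in> {1..t}" for i
  proof -
    interpret field "F i" by (rule is_field[OF that])
    show ?thesis
      using that assms by (simp add: coord_mult coord_closed integral_iff)
  qed
  then show ?thesis by (auto simp: support_def)
qed

lemma mult_eq_zero_iff:
  assumes "x \<in> carrier R" "y \<in> carrier R"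
  shows "x \<otimes>\<^bsub>R\<^esub> y = \<zero>\<^bsub>R\<^esub> \<longleftrightarrow> support x \<inter> support y = {}"
  using assms support_eq_empty_iff[OF length_mult] by (simp add: support_mult)

section \<open>Finiteness, and counting the elements with a given support\<close>

lemma finite_carrier: "finite (carrier R)"
proof (rule finite_subset)
  show "carrier R \<subseteq> {xs. set xs \<subseteq> (\<Union>i\<in>{1..t}. carrier (F i)) \<and> length xs = t}"
  proof safe
    fix x a assume x: "x \<in> carrier R" and "a \<in> set x"
    then obtain k where "k < t" "a = x ! k"
      by (auto simp: in_set_conv_nth length_carrier)
    then show "a \<in> (\<Union>i\<in>{1..t}. carrier (F i))"
      using coord_closed[OF x, of "Suc k"] by (force simp: coord_def)
  qed (rule length_carrier)
  show "finite {xs. set xs \<subseteq> (\<Union>i\<in>{1..t}. carrier (F i)) \<and> length xs = t}"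
    using finite_factor by (intro finite_lists_length_eq) blast
qed

text \<open>An element with support \<open>A\<close> is zero outside \<open>A\<close>, so
  restricting its coordinates to \<open>A\<close> loses nothing; the restriction is a choice of one
  nonzero element of \<open>F i\<close> for each \<open>i\<close> in \<open>A\<close>.\<close>

lemma card_support_eq_le:
  assumes "A \<subseteq> {1..t}"
  shows "card {x \<in> carrier R. support x = A} \<le> (\<Prod>i\<in>A. order (F i) - 1)"
proof -
  let ?S = "{x \<in> carrier R. support x = A}"
  let ?f = "\<lambda>x. \<lambda>i\<in>A. coord x i"
  let ?T = "PiE A (\<lambda>i. carrier (F i) - {\<zero>\<^bsub>F i\<^esub>})"
  have fin: "finite A" using assms finite_subset by blast
  have "inj_on ?f ?S"
  proof (rule inj_onI)
    fix x y assume x: "x \<in> ?S" and y: "y \<in> ?S" and eq: "?f x = ?f y"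
    have "coord x i = coord y i" if "i \<in> {1..t}" for i
    proof (cases "i \<in> A")
      case True
      then show ?thesis using fun_cong[OF eq, of i] by simp
    next
      case False
      then have "i \<notin> support x" "i \<notin> support y" using x y by simp_all
      then show ?thesis using that by (simp add: support_def)
    qed
    with x y show "x = y" by (intro coord_eqI) (auto simp: length_carrier)
  qed
  moreover have "?f ` ?S \<subseteq> ?T"
  proof (intro image_subsetI PiE_I)
    fix x i assume x: "x \<in> ?S" and "i \<in> A"
    then have "i \<in> support x" by simp
    then have "i \<in> {1..t}" "coord x i \<noteq> \<zero>\<^bsub>F i\<^esub>" unfolding support_def by blast+
    with x \<open>i \<in> A\<close> show "?f x i \<in> carrier (F i) - {\<zero>\<^bsub>F i\<^esub>}"
      using coord_closed by simp
  qed simp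
  moreover have "finite ?T"
    using fin assms finite_factor by (intro finite_PiE) blast+
  ultimately have "card ?S \<le> card ?T" by (rule card_inj_on_le)
  also have "card ?T = (\<Prod>i\<in>A. order (F i) - 1)"
  proof -
    have "card (carrier (F i) - {\<zero>\<^bsub>F i\<^esub>}) = order (F i) - 1" if "i \<in> A" for i
    proof -
      interpret field "F i" using that assms is_field by blast
      show ?thesis
        using that assms finite_factor[of i] by (simp add: order_def card_Diff_singleton)
    qed
    then show ?thesis using fin by (simp add: card_PiE)
  qed
  finally show ?thesis .
qed

section \<open>Zero divisors and edges in terms of supports\<close>

lemma support_zero_divisor:
  assumes "x \<in> nonzero_zero_divisors R"
  shows "x \<in> carrier R" "support x \<noteq> {}" "support x \<subset> {1..t}"
proof -
  from assms obtain y where x: "x \<in> carrier R" "x \<noteq> \<zero>\<^bsub>R\<^esub>"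
    and y: "y \<in> carrier R" "y \<noteq> \<zero>\<^bsub>R\<^esub>" "x \<otimes>\<^bsub>R\<^esub> y = \<zero>\<^bsub>R\<^esub>"
    by (auto simp: nonzero_zero_divisors_def zero_divisors_def)
  show "x \<in> carrier R" by fact
  show "support x \<noteq> {}" using x by (simp add: support_eq_empty_iff length_carrier)
  \<comment> \<open>The support of the annihilating partner is nonempty and disjoint from that of
    \<open>x\<close>, so \<open>x\<close> misses a coordinate.\<close>
  have "support y \<noteq> {}" using y by (simp add: support_eq_empty_iff length_carrier)
  moreover have "support x \<inter> support y = {}" using x y by (simp add: mult_eq_zero_iff)
  ultimately show "support x \<subset> {1..t}"
    using support_subset[of x] support_subset[of y] by blast
qed

text \<open>Disjoint supports would give an edge of the zero-divisor graph, which has been removed.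
  If both supports omit only one index \<open>i\<close>, every nonzero annihilator of either vertex
  has support exactly \<open>{i}\<close>, and two such annihilators have a nonzero product, so there
  is no weak edge.\<close>

lemma difference_graph_edgeD:
  assumes "{x, y} \<in> snd (weak_zero_divisor_difference_graph R)" and "x \<noteq> y"
  shows "support x \<inter> support y \<noteq> {}"
    and "support x = support y \<Longrightarrow> card (support x) \<noteq> t - 1"
proof -
  have weak: "{x, y} \<in> snd (weak_zero_divisor_graph R)"
    and not_adj: "{x, y} \<notin> snd (zero_divisor_graph R)"
    using assms by (auto simp: weak_zero_divisor_difference_graph_def delete_isolated_def)
  from weak obtain a b r s where ab: "{x, y} = {a, b}"
    "a \<in> nonzero_zero_divisors R" "b \<in> nonzero_zero_divisors R"
    and r: "r \<in> annihilator R a" "r \<noteq> \<zero>\<^bsub>R\<^esub>"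
    and s: "s \<in> annihilator R b" "s \<noteq> \<zero>\<^bsub>R\<^esub>"
    and rs: "r \<otimes>\<^bsub>R\<^esub> s = \<zero>\<^bsub>R\<^esub>"
    by (auto simp: weak_zero_divisor_graph_def)
  have vertices: "x \<in> nonzero_zero_divisors R" "y \<in> nonzero_zero_divisors R"
    using ab by (auto simp: doubleton_eq_iff)
  with not_adj \<open>x \<noteq> y\<close> have "x \<otimes>\<^bsub>R\<^esub> y \<noteq> \<zero>\<^bsub>R\<^esub>"
    by (auto simp: zero_divisor_graph_def)
  with vertices show "support x \<inter> support y \<noteq> {}"
    by (simp add: mult_eq_zero_iff support_zero_divisor(1))
  assume eq: "support x = support y"
  show "card (support x) \<noteq> t - 1"
  proof
    assume card: "card (support x) = t - 1"
    \<comment> \<open>The edge is unordered, so \<open>(a, b)\<close> may be \<open>(x, y)\<close>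
      or \<open>(y, x)\<close>; equality of the supports makes the order immaterial.\<close>
    have supp: "support a = support x" "support b = support x"
      using ab(1) eq by (auto simp: doubleton_eq_iff)
    have carr: "a \<in> carrier R" "b \<in> carrier R" "r \<in> carrier R" "s \<in> carrier R"
      using ab r s by (auto simp: support_zero_divisor annihilator_def)
    \<comment> \<open>This rules out truncation in \<open>t - 1\<close>, so that the complement of
      the support has exactly one element.\<close>
    have "t \<noteq> 0" using support_zero_divisor(3)[OF vertices(1)] by auto
    then have "card ({1..t} - support x) = 1"
      using card support_subset[of x] by (simp add: card_Diff_subset finite_subset)
    then obtain i where i: "{1..t} - support x = {i}" by (auto simp: card_1_singleton_iff)
    have "support r \<inter> support x = {}" "support s \<inter> support x = {}"
      using r s carr supp by (auto simp: annihilator_def mult_eq_zero_iff)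
    then have "support r \<subseteq> {i}" "support s \<subseteq> {i}"
      using i support_subset[of r] support_subset[of s] by blast+
    moreover have "support r \<noteq> {}" "support s \<noteq> {}"
      using carr r s by (simp_all add: support_eq_empty_iff length_carrier)
    moreover have "support r \<inter> support s = {}"
      using rs carr by (simp add: mult_eq_zero_iff)
    ultimately show False by blast
  qed
qed

section \<open>Bounding a clique support by support\<close>

lemma clique_support_card_le:
  assumes t: "t \<ge> 2"
    and q: "\<And>i. i \<in> {1..t} \<Longrightarrow> order (F i) = q i"
    and K: "K \<subseteq> nonzero_zero_divisors R"
    and clique: "clique K (snd (weak_zero_divisor_difference_graph R))"
    and A: "A \<subset> {1..t}"
  shows "card {x \<in> K. support x = A} \<le> val t q A"
proof (cases "card A \<le> t - 2")
  case True
  have "card {x \<in> K. support x = A} \<le> card {x \<in> carrier R. support x = A}"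
    using K by (intro card_mono) (auto simp: finite_carrier support_zero_divisor(1))
  also have "\<dots> \<le> (\<Prod>i\<in>A. order (F i) - 1)" using A by (intro card_support_eq_le) auto
  also have "\<dots> = (\<Prod>i\<in>A. q i - 1)" using A q by (intro prod.cong) auto
  finally show ?thesis using True by (simp add: val_def)
next
  case False
  have "finite K"
    using K finite_carrier support_zero_divisor(1) by (meson finite_subset subsetI subset_trans)
  then have fin: "finite {x \<in> K. support x = A}" by simp
  have "card A < t" using psubset_card_mono[OF _ A] by simp
  with False t have "card A = t - 1" by simp
  \<comment> \<open>Two distinct such elements would be joined by an edge of the clique, against the
    second part of \<open>difference_graph_edgeD\<close>.\<close>
  then have "x = y" if "x \<in> K" "support x = A" "y \<in> K" "support y = A" for x y
    using that clique difference_graph_edgeD(2)[of x y] by (auto simp: clique_def)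
  then have "card {x \<in> K. support x = A} \<le> 1"
    using fin by (auto simp: card_le_Suc0_iff_eq)
  then show ?thesis using False by (simp add: val_def)
qed

lemma clique_complementary_pair_card_le:
  assumes t: "t \<ge> 2"
    and q: "\<And>i. i \<in> {1..t} \<Longrightarrow> order (F i) = q i"
    and K: "K \<subseteq> nonzero_zero_divisors R"
    and clique: "clique K (snd (weak_zero_divisor_difference_graph R))"
    and P: "P \<in> complementary_pairs t"
  shows "card {x \<in> K. support x \<in> P} \<le> Max (val t q ` P)"
proof -
  from P obtain A where A: "P = {A, {1..t} - A}" "A \<noteq> {}" "A \<subset> {1..t}"
    unfolding complementary_pairs_def by (elim CollectE exE conjE)
  have not_both: "\<not> (support x = A \<and> support y = {1..t} - A)" if "x \<in> K" "y \<in> K" for x y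
  proof
    assume xy: "support x = A \<and> support y = {1..t} - A"
    \<comment> \<open>A common element would have a support equal to its own complement in
      \<open>{1..t}\<close>, forcing \<open>A\<close> and \<open>{1..t}\<close> to be empty.\<close>
    then have "x \<noteq> y" using A(2) by auto
    with that clique have "support x \<inter> support y \<noteq> {}"
      by (intro difference_graph_edgeD(1)) (auto simp: clique_def)
    with xy show False by auto
  qed
  \<comment> \<open>By \<open>not_both\<close>, only one member \<open>B\<close> of the pair can
    occur as a support in \<open>K\<close>. If neither occurs, \<open>B\<close> is the complement of
    \<open>A\<close> and both sets are empty.\<close>
  obtain B where B: "B \<in> P" "{x \<in> K. support x \<in> P} = {x \<in> K. support x = B}"
  proof (cases "\<exists>x\<in>K. support x = A")
    case True
    then have "{x \<in> K. support x \<in> P} = {x \<in> K. support x = A}"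
      using not_both unfolding A(1) by fast
    then show ?thesis using that[of A] A(1) by blast
  next
    case False
    then have "{x \<in> K. support x \<in> P} = {x \<in> K. support x = {1..t} - A}"
      unfolding A(1) by fast
    then show ?thesis using that[of "{1..t} - A"] A(1) by blast
  qed
  have "B \<subset> {1..t}" using B(1) A by auto
  then have "card {x \<in> K. support x \<in> P} \<le> val t q B"
    using clique_support_card_le[OF t q K clique] B(2) by simp
  also have "\<dots> \<le> Max (val t q ` P)" using B(1) A(1) by (intro Max_ge) auto
  finally show ?thesis .
qed

lemma clique_card_le:
  assumes t: "t \<ge> 2"
    and q: "\<And>i. i \<in> {1..t} \<Longrightarrow> order (F i) = q i"
    and K: "K \<subseteq> nonzero_zero_divisors R"
    and clique: "clique K (snd (weak_zero_divisor_difference_graph R))"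
  shows "card K \<le> (\<Sum>P\<in>complementary_pairs t. Max (val t q ` P))"
proof -
  have fin: "finite (complementary_pairs t)"
    by (rule finite_subset[of _ "Pow (Pow {1..t})"]) (auto simp: complementary_pairs_def)
  \<comment> \<open>Supports of vertices are nonempty and proper, so each vertex falls under the
    pair formed by its support and the complement; a union bound then finishes.\<close>
  have "K = (\<Union>P\<in>complementary_pairs t. {x \<in> K. support x \<in> P})"
  proof -
    have "{support x, {1..t} - support x} \<in> complementary_pairs t" if "x \<in> K" for x
      using that K support_zero_divisor(2,3)[of x] unfolding complementary_pairs_def by blast
    then show ?thesis by blast
  qed
  then have "card K \<le> (\<Sum>P\<in>complementary_pairs t. card {x \<in> K. support x \<in> P})"
    using card_UN_le[OF fin, of "\<lambda>P. {x \<in> K. support x \<in> P}"] by simp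
  also have "\<dots> \<le> (\<Sum>P\<in>complementary_pairs t. Max (val t q ` P))"
    by (intro sum_mono clique_complementary_pair_card_le assms)
  finally show ?thesis .
qed

end

lemma clique_number_le:
  assumes "finite (fst G)" "\<And>K. K \<subseteq> fst G \<Longrightarrow> clique K (snd G) \<Longrightarrow> card K \<le> n"
  shows "clique_number G \<le> n"
proof -
  \<comment> \<open>The empty clique is a witness; \<open>Max.boundedI\<close> requires a nonempty
    set.\<close>
  have "{card K | K. K \<subseteq> fst G \<and> clique K (snd G)} \<noteq> {}"
    using null_clique by blast
  then show ?thesis
    unfolding clique_number_def using assms by (intro Max.boundedI) auto
qed

theorem proposition6p7:
  fixes F :: "nat \<Rightarrow> ('a, 'b) ring_scheme"
    and q :: "nat \<Rightarrow> nat"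
    and t :: nat
    and R :: "'a list ring"
  assumes "t \<ge> 3"
    and "\<And>i. i \<in> {1..t} \<Longrightarrow> field (F i)"
    and "\<And>i. i \<in> {1..t} \<Longrightarrow> finite (carrier (F i))"
    and "\<And>i. i \<in> {1..t} \<Longrightarrow> order (F i) = q i"
    and "R = RDirProd_list (map F [1..<t + 1])"
  shows "clique_number (weak_zero_divisor_difference_graph R)
      \<le> (\<Sum>P\<in>complementary_pairs t. Max (val t q ` P))"
proof -
  interpret P: product_of_fields F t
    using assms(2,3) by (rule product_of_fields.intro)
  have R: "R = P.R" using assms(5) by (simp add: P.R_def)
  \<comment> \<open>Deleting isolated vertices only shrinks the vertex set, so the bound for cliques
    among all nonzero zero divisors applies.\<close>
  have vertices: "fst (weak_zero_divisor_difference_graph R) \<subseteq> nonzero_zero_divisors P.R"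
    by (auto simp: R weak_zero_divisor_difference_graph_def delete_isolated_def)
  show ?thesis
  proof (rule clique_number_le)
    show "finite (fst (weak_zero_divisor_difference_graph R))"
      using vertices P.finite_carrier P.support_zero_divisor(1)
      by (meson finite_subset subsetI subset_trans)
    fix K assume "K \<subseteq> fst (weak_zero_divisor_difference_graph R)"
      and "clique K (snd (weak_zero_divisor_difference_graph R))"
    with vertices show "card K \<le> (\<Sum>P\<in>complementary_pairs t. Max (val t q ` P))"
      using assms(1,4) by (intro P.clique_card_le) (auto simp: R)
  qed
qed

end
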